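(* Let $N$ be the event-activity network of a line network $(G,\mathcal L)$ with period $T\in\mathbb N$, $T\ge1$, and bounds $l\le u$ in $\mathbb Z^{A(N)}$, let $D$ be the expanded event-activity network, let $\mathcal{OD}$ be the set of OD-pairs with path sets $P_{st}$, $(s,t)\in\mathcal{OD}$, and let $P$ be the union of all $P_{st}$. The linear map $$\phi:\mathbb Q^C\times\mathbb Q^P\to\mathbb Q^{X(D)}\times\mathbb Q^P,\qquad \phi(x,y)=(\bar x,y),\quad \bar x_a=\sum_{c\in C:a\in c}x_c\ \ (a\in X(D)),$$ has the properties $$\phi(P_{MIP}(\mathrm{cXTTP}))=P_{MIP}(\mathrm{XTTP}),\qquad \phi(P_{LP}(\mathrm{cXTTP}))\subseteq P_{LP}(\mathrm{XTTP}).$$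
   Context: **Event-activity network.** A line network is a finite undirected graph $G$ with a finite set $\mathcal L$ of lines, each line $L=(v_1,\dots,v_n)$ being a path in $G$ with at least one edge. The event-activity network $N$ is the directed graph whose nodes are called events and whose arcs are called activities. For each line $L=(v_1,\dots,v_n)$ and each $1\le i\le n-1$ it has events $(v_i,L,dep,+)$, $(v_{i+1},L,arr,+)$, $(v_{i+1},L,dep,-)$, $(v_i,L,arr,-)$ and driving activities $((v_i,L,dep,+),(v_{i+1},L,arr,+))$, $((v_{i+1},L,dep,-),(v_i,L,arr,-))$; for each stop $v$ of $L$ and $s\in\{+,-\}$ a waiting activity $((v,L,arr,s),(v,L,dep,s))$ if both events exist; turnaround activities $((v_1,L,arr,-),(v_1,L,dep,+))$ and $((v_n,L,arr,+),(v_n,L,dep,-))$; and for every ordered pair of distinct lines $L,L'$, every common stop $v$ and $s_1,s_2\in\{+,-\}$ a transfer activity $((v,L,arr,s_1),(v,L',dep,s_2))$ if both events exist. $X(N)$ is the set of vehicle activities (driving, waiting, turnaround). The line cycle $\gamma_L$ is the directed cycle in $N$ formed by all events and vehicle activities of $L$. **Expanded network.** $[T]=\{0,\dots,T-1\}$, and $k \bmod T\in[T]$. $V(D)=\{v[t] : v\in V(N),t\in[T]\}$. For $\alpha=(v,w)\in A(N)$ let $\mathcal A(\alpha)=\{(v[t],w[t']) : t,t'\in[T],\ (t'-t-l_\alpha)\bmod T\le u_\alpha-l_\alpha\}$, and $A(D)=\bigcup_\alpha \mathcal A(\alpha)$. $X(D)=\bigcup_{\alpha\in X(N)}\mathcal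 A(\alpha)$. $\delta^{\pm}_{X(D)}(v)$ are the outgoing/ingoing arcs of $v$ in $X(D)$. The expanded line cycle of $L$ is $D$ restricted to the nodes $v[t]$ with $v\in V(\gamma_L)$, $t\in[T]$. A cycle of $L$ is a closed (directed, simple) path $c$ in the expanded line cycle with $|V(c)|=|V(\gamma_L)|$; $C_L$ is the set of cycles of $L$ and $C=\bigcup_{L}C_L$. **Passenger paths.** $\mathcal{OD}$ is a finite set of origin-destination pairs $(s,t)$ (pairs with positive demand); for each such pair $P_{st}$ is the finite set of possible paths from $s$ to $t$ in $D$ (possibly augmented by artificial origin/destination nodes and arcs, which do not belong to $X(D)$). The path sets of different pairs are disjoint, as $s,t$ are determined by $p$. **Polyhedra.** $P_{LP}(\mathrm{XTTP})$ is the set of $(x,y)\in\mathbb Q^{X(D)}\times\mathbb Q^P$ such that - $\sum_{a\in\mathcal A(\alpha)}x_a=1$ for all $\alpha\in X(N)$; - $\sum_{a\in\delta^-_{X(D)}(v)}x_a-\sum_{a\in\delta^+_{X(D)}(v)}x_a=0$ for all $v\in V(D)$; - $x_a-\sum_{p\in P_{st}:a\in p}y_p\ge0$ for all $(s,t)\in\mathcal{OD}$, $a\in X(D)$; - $\sum_{p\in P_{st}}y_p=1$ for all $(s,t)\in\mathcal{OD}$; - $0\le x_a\le1$ for all $a\in X(D)$, and $y_p\ge0$ for all $p\in P$. $P_{MIP}(\mathrm{XTTP})$ is the convex hull of those points of $P_{LP}(\mathrm{XTTP})$ with $x\in\mathbb Z^{X(D)}$. $P_{LP}(\mathrm{cXTTP})$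 is the set of $(x,y)\in\mathbb Q^{C}\times\mathbb Q^P$ such that - $\sum_{c\in C_L}x_c=1$ for all $L\in\mathcal L$; - $\sum_{p\in P_{st}}y_p=1$ for all $(s,t)\in\mathcal{OD}$; - $\sum_{c\in C:a\in c}x_c-\sum_{p\in P_{st}:a\in p}y_p\ge0$ for all $a\in X(D)$, $(s,t)\in\mathcal{OD}$; - $x_c\ge0$ for all $c\in C$, and $y_p\ge0$ for all $p\in P$. $P_{MIP}(\mathrm{cXTTP})$ is the convex hull of those points of $P_{LP}(\mathrm{cXTTP})$ with $x\in\mathbb Z^{C}$. Convex hulls are taken over $\mathbb Q$. *)

theory Defs
  imports
    Main
    "HOL-Library.Function_Algebras"
    "HOL-Library.Product_Plus"
    "Graph_Theory.Graph_Theory"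
    "Graph_Theory.Vertex_Walk"
begin

section \<open>Event-activity network\<close>

datatype event_kind = Arr | Dep
datatype direction = Fwd | Bwd

text \<open>A line is the list of its stops. Undirected graphs are modelled, as in the
  Graph-Theory library, by symmetric digraphs.\<close>

type_synonym 'v line = "'v list"
type_synonym 'v event = "'v \<times> 'v line \<times> event_kind \<times> direction"
type_synonym 'v activity = "'v event \<times> 'v event"

definition line_network :: "('v, 'e) pre_digraph \<Rightarrow> 'v line set \<Rightarrow> bool" where
  "line_network G Ls \<longleftrightarrow> fin_digraph G \<and> sym_digraph G \<and> finite Ls \<and>
     (\<forall>L\<in>Ls. vpath L G \<and> vwalk_length L \<ge> 1)"

text \<open>List positions start at 0, so the index \<open>i\<close> below is the textbook index minus one.\<close>

definition events :: "'v line \<Rightarrow> 'v event set" where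
  "events L = (\<Union>i\<in>{i. Suc i < length L}.
     {(L ! i, L, Dep, Fwd), (L ! Suc i, L, Arr, Fwd),
      (L ! Suc i, L, Dep, Bwd), (L ! i, L, Arr, Bwd)})"

definition driving :: "'v line \<Rightarrow> 'v activity set" where
  "driving L = (\<Union>i\<in>{i. Suc i < length L}.
     {((L ! i, L, Dep, Fwd), (L ! Suc i, L, Arr, Fwd)),
      ((L ! Suc i, L, Dep, Bwd), (L ! i, L, Arr, Bwd))})"

definition waiting :: "'v line \<Rightarrow> 'v activity set" where
  "waiting L = {((v, L, Arr, s), (v, L, Dep, s)) | v s.
     v \<in> set L \<and> (v, L, Arr, s) \<in> events L \<and> (v, L, Dep, s) \<in> events L}"

definition turnaround :: "'v line \<Rightarrow> 'v activity set" where
  "turnaround L = {((hd L, L, Arr, Bwd), (hd L, L, Dep, Fwd)),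
                   ((last L, L, Arr, Fwd), (last L, L, Dep, Bwd))}"

definition vehicle_activities :: "'v line \<Rightarrow> 'v activity set" where
  "vehicle_activities L = driving L \<union> waiting L \<union> turnaround L"

definition transfers :: "'v line set \<Rightarrow> 'v activity set" where
  "transfers Ls = {((v, L, Arr, s1), (v, L', Dep, s2)) | v L L' s1 s2.
     L \<in> Ls \<and> L' \<in> Ls \<and> L \<noteq> L' \<and> v \<in> set L \<and> v \<in> set L' \<and>
     (v, L, Arr, s1) \<in> events L \<and> (v, L', Dep, s2) \<in> events L'}"

definition vehicle_acts :: "'v line set \<Rightarrow> 'v activity set" where
  "vehicle_acts Ls = (\<Union>L\<in>Ls. vehicle_activities L)"

definition ean :: "'v line set \<Rightarrow> 'v event pair_pre_digraph" where
  "ean Ls = \<lparr> pverts = (\<Union>L\<in>Ls. events L), parcs = vehicle_acts Ls \<union> transfers Ls \<rparr>"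

definition line_cycle :: "'v line \<Rightarrow> 'v event pair_pre_digraph" where
  "line_cycle L = \<lparr> pverts = events L, parcs = vehicle_activities L \<rparr>"


section \<open>Expanded network\<close>

text \<open>The node \<open>v[t]\<close> is the pair \<open>(v, t)\<close>.\<close>

type_synonym 'v xnode = "'v event \<times> nat"
type_synonym 'v xarc = "'v xnode \<times> 'v xnode"

definition xarcs :: "nat \<Rightarrow> ('v activity \<Rightarrow> int) \<Rightarrow> ('v activity \<Rightarrow> int) \<Rightarrow> 'v activity \<Rightarrow> 'v xarc set" where
  "xarcs T l u \<alpha> = {((fst \<alpha>, t), (snd \<alpha>, t')) | t t'.
     t < T \<and> t' < T \<and> (int t' - int t - l \<alpha>) mod int T \<le> u \<alpha> - l \<alpha>}"

definition xean :: "'v line set \<Rightarrow> nat \<Rightarrow> ('v activity \<Rightarrow> int) \<Rightarrow> ('v activity \<Rightarrow> int) \<Rightarrow>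
    'v xnode pair_pre_digraph" where
  "xean Ls T l u = \<lparr> pverts = pverts (ean Ls) \<times> {..<T},
                     parcs = (\<Union>\<alpha>\<in>parcs (ean Ls). xarcs T l u \<alpha>) \<rparr>"

definition xvehicle :: "'v line set \<Rightarrow> nat \<Rightarrow> ('v activity \<Rightarrow> int) \<Rightarrow> ('v activity \<Rightarrow> int) \<Rightarrow>
    'v xarc set" where
  "xvehicle Ls T l u = (\<Union>\<alpha>\<in>vehicle_acts Ls. xarcs T l u \<alpha>)"

definition xline_cycle :: "'v line set \<Rightarrow> nat \<Rightarrow> ('v activity \<Rightarrow> int) \<Rightarrow> ('v activity \<Rightarrow> int) \<Rightarrow>
    'v line \<Rightarrow> ('v xnode, 'v xarc) pre_digraph" where
  "xline_cycle Ls T l u L =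
     with_proj (xean Ls T l u) \<restriction> (pverts (line_cycle L) \<times> {..<T})"

text \<open>The library predicate \<open>cycle\<close> speaks about arc lists of closed walks without
  repeated nodes. A cycle is represented by its arc set, so that
  the rotations of one closed walk count as a single cycle; its node set is then \<open>Field c\<close>.\<close>

definition line_cycles :: "'v line set \<Rightarrow> nat \<Rightarrow> ('v activity \<Rightarrow> int) \<Rightarrow> ('v activity \<Rightarrow> int) \<Rightarrow>
    'v line \<Rightarrow> 'v xarc set set" where
  "line_cycles Ls T l u L = {c. (\<exists>p. pre_digraph.cycle (xline_cycle Ls T l u L) p \<and> c = set p) \<and>
     card (Field c) = card (pverts (line_cycle L))}"

definition all_cycles :: "'v line set \<Rightarrow> nat \<Rightarrow> ('v activity \<Rightarrow> int) \<Rightarrow> ('v activity \<Rightarrow> int) \<Rightarrow>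
    'v xarc set set" where
  "all_cycles Ls T l u = (\<Union>L\<in>Ls. line_cycles Ls T l u L)"


section \<open>Passenger paths\<close>

text \<open>Nodes of the augmented network are \<open>Inl v\<close> for a node \<open>v\<close> of the expanded network and
  \<open>Inr z\<close> for an artificial node \<open>z \<in> Z\<close>; \<open>B\<close> is the set of artificial arcs.
  Taking \<open>Z\<close> and \<open>B\<close> empty gives the expanded network itself. Paths are lists of nodes,
  which determine their end nodes even if they have no arc.\<close>

type_synonym ('v, 'z) anode = "'v xnode + 'z"
type_synonym ('v, 'z) apath = "('v, 'z) anode list"

definition emb :: "'v xarc \<Rightarrow> ('v, 'z) anode \<times> ('v, 'z) anode" where
  "emb = map_prod Inl Inl"

definition augmented :: "'v xnode pair_pre_digraph \<Rightarrow> 'z set \<Rightarrow>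
    (('v, 'z) anode \<times> ('v, 'z) anode) set \<Rightarrow> ('v, 'z) anode pair_pre_digraph" where
  "augmented D Z B = \<lparr> pverts = Inl ` pverts D \<union> Inr ` Z, parcs = emb ` parcs D \<union> B \<rparr>"

definition od_path :: "('v, 'z) anode pair_pre_digraph \<Rightarrow> ('v, 'z) anode \<Rightarrow> ('v, 'z) anode \<Rightarrow>
    ('v, 'z) apath \<Rightarrow> bool" where
  "od_path H s t p \<longleftrightarrow> vpath p (with_proj H) \<and> hd p = s \<and> last p = t"

text \<open>\<open>uses p a\<close> is \<open>a \<in> p\<close> for an arc \<open>a\<close> of the expanded network.\<close>

definition uses :: "('v, 'z) apath \<Rightarrow> 'v xarc \<Rightarrow> bool" where
  "uses p a \<longleftrightarrow> emb a \<in> set (vwalk_arcs p)"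

definition all_paths :: "(('v, 'z) anode \<times> ('v, 'z) anode) set \<Rightarrow>
    (('v, 'z) anode \<Rightarrow> ('v, 'z) anode \<Rightarrow> ('v, 'z) apath set) \<Rightarrow> ('v, 'z) apath set" where
  "all_paths OD P = (\<Union>(s, t)\<in>OD. P s t)"


section \<open>Rational vectors and convex hulls\<close>

text \<open>For a finite set \<open>I\<close>, the space of rational vectors indexed by \<open>I\<close> consists of the
  functions that vanish outside \<open>I\<close>. The library notion \<open>convex\<close> is restricted to real
  vector spaces; \<open>qconvex\<close> is its rational version.\<close>

definition qvec :: "'i set \<Rightarrow> ('i \<Rightarrow> rat) set" where
  "qvec I = {x. \<forall>i. i \<notin> I \<longrightarrow> x i = 0}"

definition qscale :: "rat \<Rightarrow> ('i \<Rightarrow> rat) \<times> ('j \<Rightarrow> rat) \<Rightarrow> ('i \<Rightarrow> rat) \<times> ('j \<Rightarrow> rat)" where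
  "qscale q z = ((\<lambda>i. q * fst z i), (\<lambda>j. q * snd z j))"

definition qconvex :: "(('i \<Rightarrow> rat) \<times> ('j \<Rightarrow> rat)) set \<Rightarrow> bool" where
  "qconvex S \<longleftrightarrow> (\<forall>z\<in>S. \<forall>w\<in>S. \<forall>a\<ge>0. \<forall>b\<ge>0. a + b = 1 \<longrightarrow> qscale a z + qscale b w \<in> S)"


section \<open>Polyhedra\<close>

definition P_LP_XTTP :: "'v line set \<Rightarrow> nat \<Rightarrow> ('v activity \<Rightarrow> int) \<Rightarrow> ('v activity \<Rightarrow> int) \<Rightarrow>
    (('v, 'z) anode \<times> ('v, 'z) anode) set \<Rightarrow>
    (('v, 'z) anode \<Rightarrow> ('v, 'z) anode \<Rightarrow> ('v, 'z) apath set) \<Rightarrow>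
    (('v xarc \<Rightarrow> rat) \<times> (('v, 'z) apath \<Rightarrow> rat)) set" where
  "P_LP_XTTP Ls T l u OD P = (let X = xvehicle Ls T l u in
     {(x, y). x \<in> qvec X \<and> y \<in> qvec (all_paths OD P) \<and>
       (\<forall>\<alpha>\<in>vehicle_acts Ls. (\<Sum>a\<in>xarcs T l u \<alpha>. x a) = 1) \<and>
       (\<forall>v\<in>pverts (xean Ls T l u).
          (\<Sum>a\<in>{a\<in>X. snd a = v}. x a) - (\<Sum>a\<in>{a\<in>X. fst a = v}. x a) = 0) \<and>
       (\<forall>(s, t)\<in>OD. \<forall>a\<in>X. x a - (\<Sum>p\<in>{p\<in>P s t. uses p a}. y p) \<ge> 0) \<and>
       (\<forall>(s, t)\<in>OD. (\<Sum>p\<in>P s t. y p) = 1) \<and>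
       (\<forall>a\<in>X. 0 \<le> x a \<and> x a \<le> 1) \<and>
       (\<forall>p\<in>all_paths OD P. y p \<ge> 0)})"

definition P_MIP_XTTP :: "'v line set \<Rightarrow> nat \<Rightarrow> ('v activity \<Rightarrow> int) \<Rightarrow> ('v activity \<Rightarrow> int) \<Rightarrow>
    (('v, 'z) anode \<times> ('v, 'z) anode) set \<Rightarrow>
    (('v, 'z) anode \<Rightarrow> ('v, 'z) anode \<Rightarrow> ('v, 'z) apath set) \<Rightarrow>
    (('v xarc \<Rightarrow> rat) \<times> (('v, 'z) apath \<Rightarrow> rat)) set" where
  "P_MIP_XTTP Ls T l u OD P =
     qconvex hull {(x, y) \<in> P_LP_XTTP Ls T l u OD P. \<forall>a\<in>xvehicle Ls T l u. x a \<in> \<int>}"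

definition P_LP_cXTTP :: "'v line set \<Rightarrow> nat \<Rightarrow> ('v activity \<Rightarrow> int) \<Rightarrow> ('v activity \<Rightarrow> int) \<Rightarrow>
    (('v, 'z) anode \<times> ('v, 'z) anode) set \<Rightarrow>
    (('v, 'z) anode \<Rightarrow> ('v, 'z) anode \<Rightarrow> ('v, 'z) apath set) \<Rightarrow>
    (('v xarc set \<Rightarrow> rat) \<times> (('v, 'z) apath \<Rightarrow> rat)) set" where
  "P_LP_cXTTP Ls T l u OD P = (let C = all_cycles Ls T l u in
     {(x, y). x \<in> qvec C \<and> y \<in> qvec (all_paths OD P) \<and>
       (\<forall>L\<in>Ls. (\<Sum>c\<in>line_cycles Ls T l u L. x c) = 1) \<and>
       (\<forall>(s, t)\<in>OD. (\<Sum>p\<in>P s t. y p) = 1) \<and>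
       (\<forall>a\<in>xvehicle Ls T l u. \<forall>(s, t)\<in>OD.
          (\<Sum>c\<in>{c\<in>C. a \<in> c}. x c) - (\<Sum>p\<in>{p\<in>P s t. uses p a}. y p) \<ge> 0) \<and>
       (\<forall>c\<in>C. x c \<ge> 0) \<and>
       (\<forall>p\<in>all_paths OD P. y p \<ge> 0)})"

definition P_MIP_cXTTP :: "'v line set \<Rightarrow> nat \<Rightarrow> ('v activity \<Rightarrow> int) \<Rightarrow> ('v activity \<Rightarrow> int) \<Rightarrow>
    (('v, 'z) anode \<times> ('v, 'z) anode) set \<Rightarrow>
    (('v, 'z) anode \<Rightarrow> ('v, 'z) anode \<Rightarrow> ('v, 'z) apath set) \<Rightarrow>
    (('v xarc set \<Rightarrow> rat) \<times> (('v, 'z) apath \<Rightarrow> rat)) set" where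
  "P_MIP_cXTTP Ls T l u OD P =
     qconvex hull {(x, y) \<in> P_LP_cXTTP Ls T l u OD P. \<forall>c\<in>all_cycles Ls T l u. x c \<in> \<int>}"

definition phi :: "'v line set \<Rightarrow> nat \<Rightarrow> ('v activity \<Rightarrow> int) \<Rightarrow> ('v activity \<Rightarrow> int) \<Rightarrow>
    ('v xarc set \<Rightarrow> rat) \<times> (('v, 'z) apath \<Rightarrow> rat) \<Rightarrow>
    ('v xarc \<Rightarrow> rat) \<times> (('v, 'z) apath \<Rightarrow> rat)" where
  "phi Ls T l u = (\<lambda>(x, y).
     ((\<lambda>a. if a \<in> xvehicle Ls T l u then \<Sum>c\<in>{c\<in>all_cycles Ls T l u. a \<in> c}. x c else 0), y))"

end

theory Submission
  imports Defs
begin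

text \<open>The vehicle activities of a line form a single directed cycle of \<open>m\<close> events, so a closed walk
  with \<open>m\<close> nodes in the expanded line cycle winds exactly once around it and uses exactly one arc
  of every \<open>\<A>(\<alpha>)\<close>. Hence \<open>\<phi>\<close> turns the cycle constraints into the activity constraints, and
  flow is conserved because every cycle enters and leaves a node equally often. Conversely, an integral
  \<open>x\<close> selects exactly one arc of every \<open>\<A>(\<alpha>)\<close>; flow conservation chains the arcs selected for one
  line to a cycle, and the indicator of these cycles is a preimage. A linear map commutes with convex
  hulls.\<close>

section \<open>The line cycle\<close>

text \<open>Each of the \<open>length L - 1\<close> edges contributes a departure and an arrival in
  both directions, hence four events; this is the length of the line cycle.\<close>

definition period :: "'v line \<Rightarrow> nat" where
  "period L = 4 * (length L - 1)"

text \<open>The events in the order of the line cycle, starting at the first departure and extended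
  periodically; the turnaround at the last stop follows the first half.\<close>

definition event_at :: "'v line \<Rightarrow> nat \<Rightarrow> 'v event" where
  "event_at L k = (let h = 2 * (length L - 1); r = k mod period L in
     if r < h then (L ! (Suc r div 2), L, if even r then Dep else Arr, Fwd)
     else (L ! (length L - 1 - Suc (r - h) div 2), L, if even r then Dep else Arr, Bwd))"

section \<open>Enumeration of the events of a line\<close>

lemma event_at_mod [simp]: "event_at L (k mod period L) = event_at L k"
  by (simp add: event_at_def)

lemma event_at_less:
  "r < 2 * (length L - 1) \<Longrightarrow>
    event_at L r = (L ! (Suc r div 2), L, if even r then Dep else Arr, Fwd)"
  by (simp add: event_at_def period_def)

lemma event_at_add:
  assumes "r < 2 * (length L - 1)"
  shows "event_at L (2 * (length L - 1) + r) =
    (L ! (length L - 1 - Suc r div 2), L, if even r then Dep else Arr, Bwd)"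
  using assms by (simp add: event_at_def period_def)

text \<open>The half of the cycle gives the direction, the parity within it the kind of event. In
  the backward half \<open>i\<close> counts edges from the end of the line.\<close>

lemma less_period_cases:
  assumes "r < period L"
  obtains (Fwd_Dep) i where "Suc i < length L" "r = 2 * i"
  | (Fwd_Arr) i where "Suc i < length L" "r = Suc (2 * i)"
  | (Bwd_Dep) i where "Suc i < length L" "r = 2 * (length L - 1) + 2 * i"
  | (Bwd_Arr) i where "Suc i < length L" "r = 2 * (length L - 1) + Suc (2 * i)"
proof (cases "r < 2 * (length L - 1)")
  case True
  show ?thesis
  proof (cases "even r")
    case True
    then obtain i where "r = 2 * i" by (elim evenE)
    with \<open>r < 2 * (length L - 1)\<close> show ?thesis by (intro Fwd_Dep[of i]) auto
  next
    case False
    then obtain i where "r = 2 * i + 1" by (elim oddE)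
    with \<open>r < 2 * (length L - 1)\<close> show ?thesis by (intro Fwd_Arr[of i]) auto
  qed
next
  case False
  define q where "q = r - 2 * (length L - 1)"
  have q: "r = 2 * (length L - 1) + q" "q < 2 * (length L - 1)"
    using False assms by (auto simp: q_def period_def)
  show ?thesis
  proof (cases "even q")
    case True
    then obtain i where "q = 2 * i" by (elim evenE)
    with q show ?thesis by (intro Bwd_Dep[of i]) auto
  next
    case False
    then obtain i where "q = 2 * i + 1" by (elim oddE)
    with q show ?thesis by (intro Bwd_Arr[of i]) auto
  qed
qed

lemma event_at_Fwd_Dep:
  "Suc i < length L \<Longrightarrow> event_at L (2 * i) = (L ! i, L, Dep, Fwd)"
  by (subst event_at_less) auto

lemma event_at_Fwd_Arr:
  "Suc i < length L \<Longrightarrow> event_at L (Suc (2 * i)) = (L ! Suc i, L, Arr, Fwd)"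
  by (subst event_at_less) auto

lemma event_at_Bwd_Dep:
  "Suc i < length L \<Longrightarrow>
    event_at L (2 * (length L - 1) + 2 * i) = (L ! (length L - 1 - i), L, Dep, Bwd)"
  by (subst event_at_add) auto

lemma event_at_Bwd_Arr:
  "Suc i < length L \<Longrightarrow>
    event_at L (2 * (length L - 1) + Suc (2 * i)) = (L ! (length L - 1 - Suc i), L, Arr, Bwd)"
  by (subst event_at_add) auto

lemmas event_at_simps = event_at_Fwd_Dep event_at_Fwd_Arr event_at_Bwd_Dep event_at_Bwd_Arr

text \<open>\<open>Suc r div 2\<close> is the position of a stop within a half: the arrival
  \<open>2 * i - 1\<close> and the departure \<open>2 * i\<close> share it, and parity tells them
  apart.\<close>

lemma Suc_half_parity_inject:
  fixes a b :: nat
  shows "Suc a div 2 = Suc b div 2 \<Longrightarrow> even a = even b \<Longrightarrow> a = b"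
  by presburger

text \<open>An event reveals its index: the direction gives the half, the kind the parity and, as no
  stop repeats, the stop gives \<open>Suc r div 2\<close>.\<close>

lemma event_at_eq_iff:
  assumes "distinct L" "2 \<le> length L"
  shows "event_at L j = event_at L k \<longleftrightarrow> j mod period L = k mod period L"
proof
  define h where "h = 2 * (length L - 1)"
  define r s where "r = j mod period L" and "s = k mod period L"
  have period: "period L = 2 * h" "h > 0" using assms by (auto simp: period_def h_def)
  then have less: "r < 2 * h" "s < 2 * h" by (auto simp: r_def s_def)
  assume "event_at L j = event_at L k"
  then have eq: "(if r < h then (L ! (Suc r div 2), L, if even r then Dep else Arr, Fwd)
      else (L ! (length L - 1 - Suc (r - h) div 2), L, if even r then Dep else Arr, Bwd)) =
    (if s < h then (L ! (Suc s div 2), L, if even s then Dep else Arr, Fwd)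
      else (L ! (length L - 1 - Suc (s - h) div 2), L, if even s then Dep else Arr, Bwd))"
    unfolding event_at_def Let_def h_def r_def s_def .
  then have parity: "even r \<longleftrightarrow> even s" by (auto split: if_splits)
  show "r = s"
  proof (cases "r < h")
    case True
    with eq have "s < h" and "L ! (Suc r div 2) = L ! (Suc s div 2)"
      by (auto split: if_splits)
    moreover from this True have "Suc r div 2 < length L" "Suc s div 2 < length L"
      by (auto simp: h_def)
    ultimately have "Suc r div 2 = Suc s div 2" using assms by (simp add: nth_eq_iff_index_eq)
    then show ?thesis using parity by (rule Suc_half_parity_inject)
  next
    case False
    with eq have "h \<le> s"
      and "L ! (length L - 1 - Suc (r - h) div 2) = L ! (length L - 1 - Suc (s - h) div 2)"
      by (auto split: if_splits)
    moreover have "length L - 1 - q < length L" for q using assms by simp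
    ultimately have "length L - 1 - Suc (r - h) div 2 = length L - 1 - Suc (s - h) div 2"
      using assms by (simp add: nth_eq_iff_index_eq)
    \<comment> \<open>Within these bounds the truncated subtraction from \<open>length L - 1\<close>
      is injective.\<close>
    moreover have "Suc (r - h) div 2 \<le> length L - 1" "Suc (s - h) div 2 \<le> length L - 1"
      using less by (auto simp: h_def)
    ultimately have "Suc (r - h) div 2 = Suc (s - h) div 2" by linarith
    moreover have "even (r - h) \<longleftrightarrow> even (s - h)"
      using parity False \<open>h \<le> s\<close> by simp
    ultimately have "r - h = s - h" by (rule Suc_half_parity_inject)
    then show ?thesis using False \<open>h \<le> s\<close> by simp
  qed
qed (metis event_at_mod)

text \<open>The line is a component of its events, so different lines have disjoint event sets;
  later this keeps their cycles apart.\<close>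

lemma fst_snd_events: "e \<in> events L \<Longrightarrow> fst (snd e) = L"
  by (auto simp: events_def)

lemma event_at_in_events:
  assumes "2 \<le> length L"
  shows "event_at L k \<in> events L"
proof -
  have "k mod period L < period L" using assms by (simp add: period_def)
  then have "event_at L (k mod period L) \<in> events L"
  proof (cases rule: less_period_cases)
    case (Fwd_Dep i)
    then show ?thesis unfolding Fwd_Dep(2) event_at_simps[OF Fwd_Dep(1)] events_def by blast
  next
    case (Fwd_Arr i)
    then show ?thesis unfolding Fwd_Arr(2) event_at_simps[OF Fwd_Arr(1)] events_def by blast
  next
    case (Bwd_Dep i)
    \<comment> \<open>The backward half counts edges from the end, so its edge \<open>i\<close> is
      edge \<open>length L - 2 - i\<close> in the definition of \<open>events\<close>.\<close>
    define j where "j = length L - 2 - i"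
    have j: "Suc j < length L" "length L - 1 - i = Suc j" using Bwd_Dep by (auto simp: j_def)
    then show ?thesis unfolding Bwd_Dep(2) event_at_simps[OF Bwd_Dep(1)] events_def j(2) by blast
  next
    case (Bwd_Arr i)
    define j where "j = length L - 2 - i"
    have j: "Suc j < length L" "length L - 1 - Suc i = j" using Bwd_Arr by (auto simp: j_def)
    then show ?thesis unfolding Bwd_Arr(2) event_at_simps[OF Bwd_Arr(1)] events_def j(2) by blast
  qed
  then show ?thesis by simp
qed

section \<open>Vehicle activities as steps along the enumeration\<close>

lemma driving_event_at:
  "driving L = (\<Union>i\<in>{i. Suc i < length L}.
     {(event_at L (2 * i), event_at L (Suc (2 * i))),
      (event_at L (2 * (length L - 1) + 2 * i), event_at L (Suc (2 * (length L - 1) + 2 * i)))})"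
    (is "_ = ?R")
proof -
  \<comment> \<open>The definition indexes backward arcs by the forward edge, the enumeration by the
    order of travel; the reflection of \<open>i\<close> to \<open>length L - 2 - i\<close> is an
    involution that exchanges the two.\<close>
  have reindex: "(\<Union>i\<in>{i. Suc i < length L}.
      {((L ! Suc i, L, Dep, Bwd), (L ! i, L, Arr, Bwd))}) =
    (\<Union>i\<in>{i. Suc i < length L}.
      {((L ! (length L - 1 - i), L, Dep, Bwd), (L ! (length L - 1 - Suc i), L, Arr, Bwd))})"
    (is "(\<Union>i\<in>?I. {?f i}) = (\<Union>i\<in>?I. {?g i})")
  proof -
    have 1: "?f i = ?g (length L - 2 - i)" and 2: "?g i = ?f (length L - 2 - i)"
      and 3: "length L - 2 - i \<in> ?I" if "i \<in> ?I" for i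
    proof -
      from that have "length L - 1 - (length L - 2 - i) = Suc i"
        "length L - 1 - Suc (length L - 2 - i) = i"
        "length L - 1 - i = Suc (length L - 2 - i)" "length L - 1 - Suc i = length L - 2 - i"
        by auto
      then show "?f i = ?g (length L - 2 - i)" "?g i = ?f (length L - 2 - i)" by simp_all
      show "length L - 2 - i \<in> ?I" using that by auto
    qed
    show ?thesis
    proof (intro equalityI subsetI)
      fix x assume "x \<in> (\<Union>i\<in>?I. {?f i})"
      then obtain i where "i \<in> ?I" "x = ?f i" by blast
      then show "x \<in> (\<Union>i\<in>?I. {?g i})" using 1 3 by blast
    next
      fix x assume "x \<in> (\<Union>i\<in>?I. {?g i})"
      then obtain i where "i \<in> ?I" "x = ?g i" by blast
      then show "x \<in> (\<Union>i\<in>?I. {?f i})" using 2 3 by blast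
    qed
  qed
  have "driving L = (\<Union>i\<in>{i. Suc i < length L}. {((L ! i, L, Dep, Fwd), (L ! Suc i, L, Arr, Fwd))}) \<union>
    (\<Union>i\<in>{i. Suc i < length L}. {((L ! Suc i, L, Dep, Bwd), (L ! i, L, Arr, Bwd))})"
    unfolding driving_def by blast
  also have "\<dots> = (\<Union>i\<in>{i. Suc i < length L}. {(event_at L (2 * i), event_at L (Suc (2 * i)))}) \<union>
    (\<Union>i\<in>{i. Suc i < length L}. {(event_at L (2 * (length L - 1) + 2 * i),
       event_at L (2 * (length L - 1) + Suc (2 * i)))})"
    unfolding reindex by (intro arg_cong2[where f = "(\<union>)"] SUP_cong) (simp_all only: event_at_simps mem_Collect_eq)
  also have "\<dots> = ?R" by auto
  finally show ?thesis .
qed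

text \<open>A turnaround is the last step of a half; for the backward half it leads from index
  \<open>period L - 1\<close> to \<open>period L\<close>, which is index 0 again.\<close>

lemma turnaround_event_at:
  assumes "2 \<le> length L"
  shows "turnaround L = {(event_at L (period L - 1), event_at L (Suc (period L - 1))),
    (event_at L (2 * (length L - 1) - 1), event_at L (Suc (2 * (length L - 1) - 1)))}"
proof -
  \<comment> \<open>\<open>n\<close> is the index of the last edge.\<close>
  obtain n where n: "length L = Suc (Suc n)" using assms by (metis Suc_le_D numeral_2_eq_2 Suc_le_mono)
  have "L \<noteq> []" using n by auto
  have "period L - 1 = 2 * (length L - 1) + Suc (2 * n)" using n by (simp add: period_def)
  then have e: "event_at L (period L - 1) = (hd L, L, Arr, Bwd)"
    using event_at_Bwd_Arr[of n L] n \<open>L \<noteq> []\<close> by (simp only:) (simp add: hd_conv_nth)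
  have "event_at L (Suc (period L - 1)) = event_at L 0"
    using event_at_mod[of L "period L"] n by (simp add: period_def)
  also have "\<dots> = (hd L, L, Dep, Fwd)"
    using event_at_Fwd_Dep[of 0 L] n \<open>L \<noteq> []\<close> by (simp add: hd_conv_nth)
  finally have f: "event_at L (Suc (period L - 1)) = (hd L, L, Dep, Fwd)" .
  have g: "event_at L (2 * (length L - 1) - 1) = (last L, L, Arr, Fwd)"
    using event_at_Fwd_Arr[of n L] n \<open>L \<noteq> []\<close> by (simp add: last_conv_nth)
  have h: "event_at L (Suc (2 * (length L - 1) - 1)) = (last L, L, Dep, Bwd)"
    using event_at_Bwd_Dep[of 0 L] n \<open>L \<noteq> []\<close> by (simp add: last_conv_nth)
  show ?thesis by (simp only: turnaround_def e f g h)
qed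

text \<open>Every event is an end of a driving activity, so the description of
  \<open>driving\<close> already covers all events.\<close>

lemma events_event_at:
  assumes "2 \<le> length L"
  shows "events L = event_at L ` {..<period L}"
proof
  show "event_at L ` {..<period L} \<subseteq> events L" using event_at_in_events[OF assms] by blast
  have mem: "event_at L k \<in> event_at L ` {..<period L}" for k
  proof (rule image_eqI)
    show "event_at L k = event_at L (k mod period L)" by simp
    show "k mod period L \<in> {..<period L}" using assms by (simp add: period_def)
  qed
  have "events L = fst ` driving L \<union> snd ` driving L"
    unfolding events_def driving_def by force
  also have "\<dots> \<subseteq> event_at L ` {..<period L}"
    unfolding driving_event_at using mem by auto
  finally show "events L \<subseteq> event_at L ` {..<period L}" .
qed

lemma card_events:
  assumes "distinct L" "2 \<le> length L"
  shows "card (events L) = period L"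
proof -
  have "inj_on (event_at L) {..<period L}"
    by (rule inj_onI) (auto simp: event_at_eq_iff[OF assms])
  then show ?thesis by (simp add: events_event_at[OF assms(2)] card_image)
qed

text \<open>As stops are distinct, the arrival and the departure at one stop in one direction have
  consecutive indices. All other combinations of cases contradict the kind or the direction.\<close>

lemma waiting_subset:
  assumes "distinct L" "2 \<le> length L"
  shows "waiting L \<subseteq> range (\<lambda>k. (event_at L k, event_at L (Suc k)))"
proof
  fix \<alpha> assume "\<alpha> \<in> waiting L"
  then obtain v s where \<alpha>: "\<alpha> = ((v, L, Arr, s), (v, L, Dep, s))"
    "(v, L, Arr, s) \<in> events L" "(v, L, Dep, s) \<in> events L"
    by (auto simp: waiting_def)
  then obtain j k where j: "j < period L" "(v, L, Arr, s) = event_at L j"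
    and k: "k < period L" "(v, L, Dep, s) = event_at L k"
    unfolding events_event_at[OF assms(2)] by blast
  have "k = Suc j"
    using j(1)
  proof (cases rule: less_period_cases)
    case (Fwd_Arr i)
    note i = this
    from k(1) show ?thesis
    proof (cases rule: less_period_cases)
      case (Fwd_Dep i')
      with i j(2) k(2) show ?thesis
        using assms by (simp add: event_at_simps nth_eq_iff_index_eq)
    qed (use i j(2) k(2) in \<open>auto simp only: event_at_simps\<close>)
  next
    case (Bwd_Arr i)
    note i = this
    from k(1) show ?thesis
    proof (cases rule: less_period_cases)
      case (Bwd_Dep i')
      have "L ! (length L - 1 - Suc i) = L ! (length L - 1 - i')"
        using i Bwd_Dep j(2) k(2) by (auto simp only: event_at_simps)
      then have "length L - 1 - Suc i = length L - 1 - i'"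
        using i Bwd_Dep assms by (auto simp: nth_eq_iff_index_eq)
      with i Bwd_Dep show ?thesis by auto
    qed (use i j(2) k(2) in \<open>auto simp only: event_at_simps\<close>)
  qed (use j in \<open>auto simp only: event_at_simps\<close>)
  with \<alpha> j k show "\<alpha> \<in> range (\<lambda>k. (event_at L k, event_at L (Suc k)))" by auto
qed

text \<open>A step from a departure is a driving activity. A step from an arrival is a waiting
  activity, or a turnaround if the half ends there.\<close>

lemma event_at_step_in_vehicle_activities:
  assumes "2 \<le> length L"
  shows "(event_at L k, event_at L (Suc k)) \<in> vehicle_activities L"
proof -
  define r where "r = k mod period L"
  have pos: "period L > 0" using assms by (simp add: period_def)
  \<comment> \<open>\<open>Suc r\<close> is left unreduced: it equals \<open>period L\<close> at the
    turnaround at the first stop.\<close>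
  have suc: "event_at L (Suc k) = event_at L (Suc r)"
    by (metis event_at_mod mod_Suc_eq r_def)
  have waitI: "(event_at L r, event_at L (Suc r)) \<in> waiting L"
    if "event_at L r = (v, L, Arr, s)" "event_at L (Suc r) = (v, L, Dep, s)" "v \<in> set L" for v s
    using that event_at_in_events[OF assms, of r] event_at_in_events[OF assms, of "Suc r"]
    by (auto simp: waiting_def)
  have "r < period L" using pos by (simp add: r_def)
  then have "(event_at L r, event_at L (Suc r)) \<in> vehicle_activities L"
  proof (cases rule: less_period_cases)
    case (Fwd_Dep i)
    then show ?thesis unfolding vehicle_activities_def driving_event_at by blast
  next
    case (Bwd_Dep i)
    then show ?thesis unfolding vehicle_activities_def driving_event_at by blast
  next
    case (Fwd_Arr i)
    show ?thesis
    proof (cases "Suc (Suc i) < length L")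
      case True
      have "Suc r = 2 * Suc i" using Fwd_Arr by simp
      then have "event_at L (Suc r) = (L ! Suc i, L, Dep, Fwd)"
        using event_at_Fwd_Dep[OF True] by simp
      moreover have "event_at L r = (L ! Suc i, L, Arr, Fwd)"
        using Fwd_Arr by (simp add: event_at_simps)
      ultimately show ?thesis using waitI Fwd_Arr by (simp add: vehicle_activities_def)
    next
      case False
      then have "r = 2 * (length L - 1) - 1" using Fwd_Arr by simp
      then show ?thesis by (simp add: vehicle_activities_def turnaround_event_at[OF assms])
    qed
  next
    case (Bwd_Arr i)
    show ?thesis
    proof (cases "Suc (Suc i) < length L")
      case True
      have "Suc r = 2 * (length L - 1) + 2 * Suc i" using Bwd_Arr by simp
      then have "event_at L (Suc r) = (L ! (length L - 1 - Suc i), L, Dep, Bwd)"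
        using event_at_Bwd_Dep[OF True] by simp
      moreover have "event_at L r = (L ! (length L - 1 - Suc i), L, Arr, Bwd)"
        using event_at_Bwd_Arr[OF Bwd_Arr(1)] Bwd_Arr(2) by simp
      ultimately show ?thesis using waitI Bwd_Arr by (simp add: vehicle_activities_def)
    next
      case False
      then have "r = period L - 1" using Bwd_Arr by (simp add: period_def)
      then show ?thesis by (simp add: vehicle_activities_def turnaround_event_at[OF assms])
    qed
  qed
  then show ?thesis by (simp add: suc) (simp add: r_def)
qed

text \<open>Together with \<open>event_at_eq_iff\<close> this says that the vehicle activities form
  one directed cycle through all events. Letting \<open>k\<close> range over all naturals makes the
  closing step an ordinary one.\<close>

lemma vehicle_activities_event_at:
  assumes "distinct L" "2 \<le> length L"
  shows "vehicle_activities L = range (\<lambda>k. (event_at L k, event_at L (Suc k)))"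
proof
  show "range (\<lambda>k. (event_at L k, event_at L (Suc k))) \<subseteq> vehicle_activities L"
    using event_at_step_in_vehicle_activities[OF assms(2)] by blast
  show "vehicle_activities L \<subseteq> range (\<lambda>k. (event_at L k, event_at L (Suc k)))"
    unfolding vehicle_activities_def using waiting_subset[OF assms]
    by (auto simp: driving_event_at turnaround_event_at[OF assms(2)])
qed

lemma card_vehicle_activities:
  assumes "distinct L" "2 \<le> length L"
  shows "card (vehicle_activities L) = period L"
proof -
  let ?step = "\<lambda>k. (event_at L k, event_at L (Suc k))"
  have "period L > 0" using assms by (simp add: period_def)
  have step_mod: "?step k = ?step (k mod period L)" for k
    by (simp add: event_at_eq_iff[OF assms] mod_Suc_eq)
  have "vehicle_activities L = ?step ` {..<period L}"
    unfolding vehicle_activities_event_at[OF assms]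
  proof (intro equalityI subsetI)
    fix \<alpha> assume "\<alpha> \<in> range ?step"
    then obtain k where "\<alpha> = ?step k" by blast
    with step_mod[of k] have "\<alpha> = ?step (k mod period L)" by simp
    then show "\<alpha> \<in> ?step ` {..<period L}" 
      using \<open>period L > 0\<close> by (intro image_eqI[of _ _ "k mod period L"]) simp_all
  qed blast
  moreover have "inj_on ?step {..<period L}"
    by (rule inj_onI) (auto simp: event_at_eq_iff[OF assms])
  ultimately show ?thesis by (simp add: card_image)
qed


section \<open>Cycles of the expanded line cycle\<close>

lemma (in pre_digraph) cas_head_eq_tail:
  "cas u p v \<Longrightarrow> Suc i < length p \<Longrightarrow> head G (p ! i) = tail G (p ! Suc i)"
proof (induction p arbitrary: u i)
  case (Cons e p)
  then show ?case by (cases i; cases p) auto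
qed simp

lemma (in pre_digraph) cas_map_upt:
  assumes "\<And>k. head G (a k) = tail G (a (Suc k))"
  shows "cas (tail G (a j)) (map a [j..<j + n]) (tail G (a (j + n)))"
proof (induction n arbitrary: j)
  case (Suc n)
  have "[j..<j + Suc n] = j # [Suc j..<Suc j + n]" by (simp add: upt_conv_Cons)
  then show ?case using Suc[of "Suc j"] assms by simp
qed simp

lemma (in pre_digraph) cas_head_last:
  "cas u p v \<Longrightarrow> p \<noteq> [] \<Longrightarrow> head G (last p) = v"
proof (induction p arbitrary: u)
  case (Cons e p)
  then show ?case by (cases "p = []") auto
qed simp

text \<open>The definition of \<open>cycle\<close> asks for distinct heads. In a closed walk tails
  and heads form the same multiset, so the tails are distinct as well: each node of a cycle has one
  arc in and one arc out.\<close>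

lemma (in pre_digraph) cycle_arcs:
  assumes "cycle p"
  shows "inj_on (tail G) (set p)" "inj_on (head G) (set p)"
    "tail G ` set p = head G ` set p" "card (head G ` set p) = length p"
proof -
  obtain u where u: "awalk u p u" "distinct (tl (awalk_verts u p))" "p \<noteq> []"
    using assms by (auto simp: cycle_def)
  then have cas: "cas u p u" by (simp add: awalk_def)
  \<comment> \<open>Both sides list the nodes of the walk, and both added end nodes are
    \<open>u\<close>.\<close>
  have "map (tail G) p @ [head G (last p)] = tail G (hd p) # map (head G) p"
    using awalk_verts_conv[of u p] awalk_verts_conv'[OF cas] u(3) by simp
  moreover have "tail G (hd p) = u" using cas u(3) by (simp add: cas_simp)
  moreover have "head G (last p) = u" using cas u(3) by (rule cas_head_last)
  ultimately have "mset (map (tail G) p @ [u]) = mset (u # map (head G) p)" by simp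
  then have eq: "mset (map (tail G) p) = mset (map (head G) p)" by simp
  have d: "distinct (map (head G) p)" using u awalk_verts_conv'[OF cas] by simp
  then have "distinct (map (tail G) p)" using eq mset_eq_imp_distinct_iff by blast
  with d show "inj_on (tail G) (set p)" "inj_on (head G) (set p)" by (auto simp: distinct_map)
  show "tail G ` set p = head G ` set p" using mset_eq_setD[OF eq] by simp
  show "card (head G ` set p) = length p" using distinct_card[OF d] by simp
qed

section \<open>Arcs and cycles over a line cycle\<close>

lemma xarcs_project: "a \<in> xarcs T l u \<alpha> \<Longrightarrow> (fst (fst a), fst (snd a)) = \<alpha>"
  by (auto simp: xarcs_def)

lemma xarcs_time: "a \<in> xarcs T l u \<alpha> \<Longrightarrow> snd (fst a) < T \<and> snd (snd a) < T"
  by (auto simp: xarcs_def)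

lemma finite_xarcs: "finite (xarcs T l u \<alpha>)"
proof (rule finite_subset)
  show "xarcs T l u \<alpha> \<subseteq> (\<lambda>(t, t'). ((fst \<alpha>, t), (snd \<alpha>, t'))) ` ({..<T} \<times> {..<T})"
    by (auto simp: xarcs_def)
qed simp

text \<open>What a line network provides for the argument: finitely many lines, no repeated stop on
  a line because it is a path, and at least two stops because it has an edge.\<close>

locale timetable =
  fixes Ls :: "'v line set" and T :: nat and l u :: "'v activity \<Rightarrow> int"
  assumes finite_lines: "finite Ls"
    and distinct_line: "L \<in> Ls \<Longrightarrow> distinct L"
    and length_line: "L \<in> Ls \<Longrightarrow> 2 \<le> length L"
begin

abbreviation "A \<equiv> xarcs T l u"
abbreviation "X \<equiv> xvehicle Ls T l u"
abbreviation "cycles \<equiv> line_cycles Ls T l u"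
abbreviation "C \<equiv> all_cycles Ls T l u"

lemma vehicle_activities_line:
  "L \<in> Ls \<Longrightarrow> vehicle_activities L = range (\<lambda>k. (event_at L k, event_at L (Suc k)))"
  by (rule vehicle_activities_event_at[OF distinct_line length_line])

lemma event_at_eq_line:
  "L \<in> Ls \<Longrightarrow> event_at L j = event_at L k \<longleftrightarrow> j mod period L = k mod period L"
  by (rule event_at_eq_iff[OF distinct_line length_line])

lemma period_pos: "L \<in> Ls \<Longrightarrow> period L > 0"
  using length_line[of L] by (simp add: period_def)

lemma vehicle_activities_line_of:
  "L \<in> Ls \<Longrightarrow> \<alpha> \<in> vehicle_activities L \<Longrightarrow> fst (snd (fst \<alpha>)) = L \<and> fst (snd (snd \<alpha>)) = L"
  by (auto simp: vehicle_activities_line fst_snd_events[OF event_at_in_events[OF length_line]])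

text \<open>The restriction is taken in the whole expanded network, but a transfer arc joins two
  different lines and so never has both ends among the events of \<open>L\<close>.\<close>

lemma arcs_xline_cycle:
  assumes "L \<in> Ls"
  shows "arcs (xline_cycle Ls T l u L) = (\<Union>\<alpha>\<in>vehicle_activities L. A \<alpha>)"
proof (intro equalityI subsetI)
  fix a assume "a \<in> arcs (xline_cycle Ls T l u L)"
  then have "a \<in> (\<Union>\<alpha>\<in>vehicle_acts Ls \<union> transfers Ls. A \<alpha>)"
    and ev: "fst (fst a) \<in> events L" "fst (snd a) \<in> events L"
    by (auto simp: xline_cycle_def xean_def ean_def line_cycle_def)
  then obtain \<alpha> where \<alpha>: "\<alpha> \<in> vehicle_acts Ls \<union> transfers Ls" "a \<in> A \<alpha>"
    by blast
  with ev have line: "fst (snd (fst \<alpha>)) = L" "fst (snd (snd \<alpha>)) = L"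
    using xarcs_project[of a T l u \<alpha>] by (auto simp: fst_snd_events)
  then have "\<alpha> \<notin> transfers Ls" by (auto simp: transfers_def)
  with \<alpha> obtain L' where "L' \<in> Ls" "\<alpha> \<in> vehicle_activities L'" by (auto simp: vehicle_acts_def)
  with line vehicle_activities_line_of have "\<alpha> \<in> vehicle_activities L" by blast
  with \<alpha> show "a \<in> (\<Union>\<alpha>\<in>vehicle_activities L. A \<alpha>)" by blast
next
  fix a assume "a \<in> (\<Union>\<alpha>\<in>vehicle_activities L. A \<alpha>)"
  then obtain \<alpha> where \<alpha>: "\<alpha> \<in> vehicle_activities L" "a \<in> A \<alpha>" by blast
  then have "\<alpha> \<in> vehicle_acts Ls" using assms by (auto simp: vehicle_acts_def)
  moreover have "fst \<alpha> \<in> events L" "snd \<alpha> \<in> events L"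
    using \<alpha>(1) event_at_in_events[OF length_line[OF assms]]
    by (auto simp: vehicle_activities_line[OF assms])
  ultimately show "a \<in> arcs (xline_cycle Ls T l u L)"
    using \<alpha>(2) xarcs_project[OF \<alpha>(2)] xarcs_time[OF \<alpha>(2)]
    by (auto simp: xline_cycle_def xean_def ean_def line_cycle_def mem_Times_iff)
qed

lemma verts_xline_cycle:
  "L \<in> Ls \<Longrightarrow> verts (xline_cycle Ls T l u L) = events L \<times> {..<T}"
  by (auto simp: xline_cycle_def xean_def ean_def line_cycle_def)

lemma tail_xline_cycle: "tail (xline_cycle Ls T l u L) = fst"
  by (simp add: xline_cycle_def)

lemma head_xline_cycle: "head (xline_cycle Ls T l u L) = snd"
  by (simp add: xline_cycle_def)

text \<open>Successive arcs project to successive steps of the line cycle, and the number of nodes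
  forces exactly \<open>period L\<close> arcs. So the walk makes one turn and meets every activity
  once.\<close>

lemma line_cyclesD:
  assumes L: "L \<in> Ls" and c: "c \<in> cycles L"
  shows "c \<subseteq> (\<Union>\<alpha>\<in>vehicle_activities L. A \<alpha>)" "finite c"
    "inj_on fst c" "inj_on snd c" "fst ` c = snd ` c"
    "\<alpha> \<in> vehicle_activities L \<Longrightarrow> card (c \<inter> A \<alpha>) = 1"
proof -
  let ?g = "event_at L"
  obtain p where p: "pre_digraph.cycle (xline_cycle Ls T l u L) p" "c = set p"
    and card: "card (Field c) = card (events L)"
    using c by (auto simp: line_cycles_def line_cycle_def)
  obtain w where "pre_digraph.awalk (xline_cycle Ls T l u L) w p w" "p \<noteq> []"
    using p(1) by (auto simp: pre_digraph.cycle_def)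
  then have sub: "set p \<subseteq> (\<Union>\<alpha>\<in>vehicle_activities L. A \<alpha>)"
    and cas: "pre_digraph.cas (xline_cycle Ls T l u L) w p w"
    by (auto simp: pre_digraph.awalk_def arcs_xline_cycle[OF L])
  show "c \<subseteq> (\<Union>\<alpha>\<in>vehicle_activities L. A \<alpha>)" using sub p(2) by simp
  show "finite c" using p(2) by simp
  note cyc = pre_digraph.cycle_arcs[OF p(1), unfolded tail_xline_cycle head_xline_cycle, folded p(2)]
  show inj: "inj_on fst c" "inj_on snd c" and eq: "fst ` c = snd ` c" using cyc by auto
  \<comment> \<open>Every node of the cycle is a head, so the condition on the number of nodes fixes
    the number of arcs.\<close>
  have "Field c = snd ` c" using eq by (simp add: Field_def Domain_fst Range_snd)
  then have len: "length p = period L"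
    using card cyc(4) card_events[OF distinct_line length_line, OF L L] by simp
  have card_c: "card c = period L" using card_image[OF inj(2)] cyc(4) len by simp
  have arc: "\<exists>k. p ! i \<in> A (?g k, ?g (Suc k))" if "i < length p" for i
  proof -
    have "p ! i \<in> set p" using that by simp
    then obtain \<alpha> where "\<alpha> \<in> vehicle_activities L" "p ! i \<in> A \<alpha>"
      using sub by blast
    then show ?thesis by (auto simp: vehicle_activities_line[OF L])
  qed
  obtain k0 where k0: "p ! 0 \<in> A (?g k0, ?g (Suc k0))" using arc[of 0] \<open>p \<noteq> []\<close> by auto
  \<comment> \<open>The node shared by two successive arcs fixes an event, and the event fixes the
    next index modulo the period.\<close>
  have step: "p ! i \<in> A (?g (k0 + i), ?g (Suc (k0 + i)))" if "i < length p" for i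
    using that
  proof (induction i)
    case 0
    then show ?case using k0 by simp
  next
    case (Suc i)
    obtain k where k: "p ! Suc i \<in> A (?g k, ?g (Suc k))" using arc[OF Suc.prems] by blast
    have "snd (p ! i) = fst (p ! Suc i)"
      using pre_digraph.cas_head_eq_tail[OF cas Suc.prems]
      by (simp add: tail_xline_cycle head_xline_cycle)
    then have "?g k = ?g (Suc (k0 + i))"
      using xarcs_project[OF k] xarcs_project[OF Suc.IH] Suc.prems by simp
    then have "k mod period L = Suc (k0 + i) mod period L" by (simp add: event_at_eq_line[OF L])
    then have "?g (Suc k) = ?g (Suc (Suc (k0 + i)))"
      unfolding event_at_eq_line[OF L] by (metis mod_Suc_eq)
    with k \<open>?g k = _\<close> show ?case by simp
  qed
  let ?proj = "\<lambda>a :: 'v xarc. (fst (fst a), fst (snd a))"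
  have im: "?proj ` c = vehicle_activities L"
  proof (intro equalityI subsetI)
    fix \<alpha> assume "\<alpha> \<in> ?proj ` c"
    then obtain a \<beta> where a: "\<alpha> = ?proj a" "\<beta> \<in> vehicle_activities L" "a \<in> A \<beta>"
      using sub p(2) by blast
    then show "\<alpha> \<in> vehicle_activities L" using xarcs_project[OF a(3)] by simp
  next
    fix \<alpha> assume "\<alpha> \<in> vehicle_activities L"
    then obtain j where j: "\<alpha> = (?g j, ?g (Suc j))" by (auto simp: vehicle_activities_line[OF L])
    define m where "m = period L"
    have "m > 0" using period_pos[OF L] by (simp add: m_def)
    \<comment> \<open>This solves \<open>k0 + i\<close> congruent to \<open>j\<close> modulo
      \<open>m\<close>: adding \<open>k0 * (m - 1)\<close> replaces subtracting \<open>k0\<close>,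
      which could leave the naturals.\<close>
    define i where "i = (j + k0 * (m - 1)) mod m"
    have "i < length p" using \<open>m > 0\<close> len by (simp add: i_def m_def)
    have "(k0 + i) mod m = (k0 + (j + k0 * (m - 1))) mod m" by (simp add: i_def mod_add_right_eq)
    also have "k0 + (j + k0 * (m - 1)) = j + k0 * m" using \<open>m > 0\<close> by (cases m) auto
    finally have *: "(k0 + i) mod m = j mod m" by simp
    then have "Suc (k0 + i) mod m = Suc j mod m" by (metis mod_Suc_eq)
    with * have "?g (k0 + i) = ?g j" "?g (Suc (k0 + i)) = ?g (Suc j)"
      by (simp_all add: event_at_eq_line[OF L] m_def)
    with step[OF \<open>i < length p\<close>] j have "?proj (p ! i) = \<alpha>" using xarcs_project by metis
    then show "\<alpha> \<in> ?proj ` c" using \<open>i < length p\<close> p(2) by force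
  qed
  \<comment> \<open>A map from \<open>c\<close> onto a finite set of the same size is injective;
    this turns at least one arc per activity into exactly one.\<close>
  then have inj_proj: "inj_on ?proj c"
    using card_vehicle_activities[OF distinct_line length_line, OF L L] card_c p(2)
    by (intro eq_card_imp_inj_on) auto
  show "card (c \<inter> A \<alpha>) = 1" if \<alpha>: "\<alpha> \<in> vehicle_activities L"
  proof -
    obtain a where a: "a \<in> c" "?proj a = \<alpha>" using \<alpha> unfolding im[symmetric] by (elim imageE) simp
    then obtain \<beta> where "a \<in> A \<beta>" using sub p(2) by blast
    then have "a \<in> A \<alpha>" using xarcs_project a(2) by metis
    moreover have "b = a" if "b \<in> c" "b \<in> A \<alpha>" for b
      using inj_onD[OF inj_proj _ that(1) a(1)] xarcs_project[OF that(2)] a(2) by simp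
    ultimately have "c \<inter> A \<alpha> = {a}" using a(1) by blast
    then show ?thesis by simp
  qed
qed

text \<open>A converse to \<open>line_cyclesD\<close>: arcs over the successive steps that chain and
  close up after one period. Their heads are distinct because the underlying events are.\<close>

lemma line_cyclesI:
  fixes a :: "nat \<Rightarrow> 'v xarc"
  assumes L: "L \<in> Ls"
    and mem: "\<And>k. a k \<in> A (event_at L k, event_at L (Suc k))"
    and chain: "\<And>k. snd (a k) = fst (a (Suc k))"
    and periodic: "a (period L) = a 0"
  shows "a ` {..<period L} \<in> cycles L"
proof -
  let ?G = "xline_cycle Ls T l u L"
  define p where "p = map a [0..<period L]"
  have len: "length p = period L" and ne: "p \<noteq> []" and set: "set p = a ` {..<period L}"
    using period_pos[OF L] by (auto simp: p_def)
  have cas: "pre_digraph.cas ?G (fst (a 0)) p (fst (a 0))"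
    using pre_digraph.cas_map_upt[of ?G a 0 "period L"] chain periodic
    by (simp add: p_def tail_xline_cycle head_xline_cycle)
  have arc: "a k \<in> (\<Union>\<alpha>\<in>vehicle_activities L. A \<alpha>)" for k
    using mem[of k] event_at_step_in_vehicle_activities[OF length_line[OF L]] by blast
  have proj: "fst (fst (a k)) = event_at L k" "fst (snd (a k)) = event_at L (Suc k)" for k
    using xarcs_project[OF mem[of k]] by auto
  have "fst (a 0) \<in> events L \<times> {..<T}"
    using proj(1)[of 0] xarcs_time[OF mem[of 0]] event_at_in_events[OF length_line[OF L]]
    by (simp add: mem_Times_iff)
  then have awalk: "pre_digraph.awalk ?G (fst (a 0)) p (fst (a 0))"
    using cas arc set by (auto simp: pre_digraph.awalk_def verts_xline_cycle[OF L] arcs_xline_cycle[OF L])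
  \<comment> \<open>Heads lie over the indices 1 to \<open>period L\<close>, one step after the
    tails.\<close>
  have inj_Suc: "inj_on (\<lambda>k. event_at L (Suc k)) {..<period L}"
  proof (rule inj_onI)
    fix j k assume *: "j \<in> {..<period L}" "k \<in> {..<period L}"
      "event_at L (Suc j) = event_at L (Suc k)"
    then have "Suc j mod period L = Suc k mod period L" by (simp add: event_at_eq_line[OF L])
    with * show "j = k" by (auto simp: mod_Suc split: if_splits)
  qed
  have "inj_on (snd \<circ> a) {..<period L}"
    by (rule inj_onI) (use proj(2) inj_onD[OF inj_Suc] in \<open>metis comp_apply\<close>)
  then have d: "distinct (map snd p)" by (simp add: p_def distinct_map atLeast0LessThan)
  have "pre_digraph.cycle ?G p"
    unfolding pre_digraph.cycle_def using awalk ne d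
    by (intro exI[of _ "fst (a 0)"]) (simp add: pre_digraph.awalk_verts_conv'[OF cas] head_xline_cycle)
  moreover from this have "card (Field (set p)) = period L"
    using pre_digraph.cycle_arcs(3,4)[of ?G p] len
    by (simp add: tail_xline_cycle head_xline_cycle Field_def Domain_fst Range_snd)
  ultimately show ?thesis
    unfolding line_cycles_def set[symmetric]
    by (auto simp: line_cycle_def card_events[OF distinct_line length_line, OF L L])
qed

end

section \<open>Double counting of cycles and their arcs\<close>

lemma sum_cycles_through:
  fixes x :: "'c set \<Rightarrow> rat"
  assumes "finite F" "finite S"
  shows "(\<Sum>a\<in>S. \<Sum>c\<in>{c \<in> F. a \<in> c}. x c) = (\<Sum>c\<in>F. of_nat (card {a \<in> S. a \<in> c}) * x c)"
  using sum.swap_restrict[OF assms(2,1), of "\<lambda>a c. x c" "\<lambda>a c. a \<in> c"] by simp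

text \<open>With \<open>f\<close> the tail or the head map and \<open>c\<close> a cycle, this is the
  out-degree or the in-degree of \<open>v\<close> in \<open>c\<close>.\<close>

lemma card_fibre:
  assumes "inj_on f c"
  shows "card {a \<in> c. f a = v} = (if v \<in> f ` c then 1 else 0)"
proof (cases "v \<in> f ` c")
  case True
  then obtain a where "a \<in> c" "f a = v" by blast
  then have "{a \<in> c. f a = v} = {a}" using assms by (auto simp: inj_on_def)
  then show ?thesis using True by simp
next
  case False
  then have none: "{a \<in> c. f a = v} = {}" by blast
  show ?thesis unfolding none using False by simp
qed

context timetable
begin

lemma finite_vehicle_activities: "L \<in> Ls \<Longrightarrow> finite (vehicle_activities L)"
  using card_vehicle_activities[OF distinct_line length_line, of L] period_pos[of L]
  by (auto intro: card_ge_0_finite)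

lemma X_eq: "X = (\<Union>L\<in>Ls. \<Union>\<alpha>\<in>vehicle_activities L. A \<alpha>)"
  by (auto simp: xvehicle_def vehicle_acts_def)

lemma finite_X: "finite X"
  unfolding X_eq using finite_lines finite_vehicle_activities finite_xarcs by blast

lemma cycles_subset_X: "L \<in> Ls \<Longrightarrow> c \<in> cycles L \<Longrightarrow> c \<subseteq> X"
  using line_cyclesD(1) unfolding X_eq by blast

lemma finite_C: "finite C"
proof (rule finite_subset)
  show "C \<subseteq> Pow X" using cycles_subset_X by (auto simp: all_cycles_def)
qed (simp add: finite_X)

text \<open>An arc determines its activity and an activity its line, so cycles of different lines
  have no arc in common.\<close>

lemma same_line:
  assumes "L \<in> Ls" "c \<in> cycles L" "a \<in> c" "L' \<in> Ls" "\<alpha> \<in> vehicle_activities L'" "a \<in> A \<alpha>"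
  shows "L' = L"
proof -
  obtain \<beta> where \<beta>: "\<beta> \<in> vehicle_activities L" "a \<in> A \<beta>"
    using line_cyclesD(1)[OF assms(1,2)] assms(3) by blast
  then have "\<alpha> = \<beta>" using xarcs_project assms(6) by metis
  then show ?thesis using vehicle_activities_line_of assms(1,4,5) \<beta>(1) by metis
qed

lemma C_E:
  assumes "c \<in> C"
  obtains L where "L \<in> Ls" "c \<in> cycles L"
  using assms by (auto simp: all_cycles_def)

lemma cycles_subset_C: "L \<in> Ls \<Longrightarrow> cycles L \<subseteq> C"
  by (auto simp: all_cycles_def)

text \<open>After exchanging the sums, the coefficient of \<open>x c\<close> is the number of arcs
  of \<open>c\<close> in \<open>A \<alpha>\<close>: one for a cycle of \<open>L\<close>, none for a
  cycle of another line.\<close>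

lemma sum_arcs_of_activity:
  fixes x :: "'v xarc set \<Rightarrow> rat"
  assumes L: "L \<in> Ls" and \<alpha>: "\<alpha> \<in> vehicle_activities L"
  shows "(\<Sum>a\<in>A \<alpha>. \<Sum>c\<in>{c \<in> C. a \<in> c}. x c) = (\<Sum>c\<in>cycles L. x c)"
proof -
  have "(\<Sum>a\<in>A \<alpha>. \<Sum>c\<in>{c \<in> C. a \<in> c}. x c) = (\<Sum>c\<in>C. of_nat (card {a \<in> A \<alpha>. a \<in> c}) * x c)"
    by (rule sum_cycles_through[OF finite_C finite_xarcs])
  also have "\<dots> = (\<Sum>c\<in>cycles L. x c)"
  proof (rule sum.mono_neutral_cong_right[OF finite_C cycles_subset_C[OF L]], safe)
    fix c assume "c \<in> C" "c \<notin> cycles L"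
    then have none: "{a \<in> A \<alpha>. a \<in> c} = {}" using same_line L \<alpha> by (elim C_E) blast
    show "of_nat (card {a \<in> A \<alpha>. a \<in> c}) * x c = 0" unfolding none by simp
  next
    fix c assume "c \<in> cycles L"
    have "{a \<in> A \<alpha>. a \<in> c} = c \<inter> A \<alpha>" by blast
    then show "of_nat (card {a \<in> A \<alpha>. a \<in> c}) * x c = x c"
      using line_cyclesD(6)[OF L \<open>c \<in> cycles L\<close> \<alpha>] by simp
  qed
  finally show ?thesis .
qed

text \<open>After exchanging the sums, the coefficient of \<open>x c\<close> is the in-degree of
  \<open>v\<close> in \<open>c\<close> on the left and its out-degree on the right; both are 1 if
  \<open>v\<close> lies on \<open>c\<close> and 0 otherwise.\<close>

lemma flow_conservation:
  fixes x :: "'v xarc set \<Rightarrow> rat"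
  shows "(\<Sum>a\<in>{a \<in> X. snd a = v}. \<Sum>c\<in>{c \<in> C. a \<in> c}. x c) =
    (\<Sum>a\<in>{a \<in> X. fst a = v}. \<Sum>c\<in>{c \<in> C. a \<in> c}. x c)"
proof -
  have fin: "finite {a \<in> X. P a}" for P using finite_X by simp
  have "card {a \<in> {a \<in> X. snd a = v}. a \<in> c} = card {a \<in> {a \<in> X. fst a = v}. a \<in> c}"
    if "c \<in> C" for c
  proof -
    obtain L where L: "L \<in> Ls" "c \<in> cycles L" using \<open>c \<in> C\<close> by (rule C_E)
    have "{a \<in> {a \<in> X. f a = v}. a \<in> c} = {a \<in> c. f a = v}" for f :: "_ \<Rightarrow> 'v xnode"
      using cycles_subset_X[OF L] by blast
    then show ?thesis
      by (simp only: card_fibre[OF line_cyclesD(3)[OF L]] card_fibre[OF line_cyclesD(4)[OF L]]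
          line_cyclesD(5)[OF L])
  qed
  then show ?thesis by (simp add: sum_cycles_through[OF finite_C fin])
qed

lemma phi_apply:
  "phi Ls T l u (x, y) = (\<lambda>a. if a \<in> X then \<Sum>c\<in>{c \<in> C. a \<in> c}. x c else 0, y)"
  by (simp add: phi_def)

lemma xarcs_subset_X: "L \<in> Ls \<Longrightarrow> \<alpha> \<in> vehicle_activities L \<Longrightarrow> A \<alpha> \<subseteq> X"
  by (auto simp: X_eq)

section \<open>Images and preimages of feasible points\<close>

lemma phi_LP:
  fixes y :: "('v, 'z) apath \<Rightarrow> rat"
  assumes "(x, y) \<in> P_LP_cXTTP Ls T l u OD P"
  shows "phi Ls T l u (x, y) \<in> P_LP_XTTP Ls T l u OD P"
proof -
  define z where "z = fst (phi Ls T l u (x, y))"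
  have z: "phi Ls T l u (x, y) = (z, y)" by (simp add: z_def phi_apply)
  have z_X: "z a = (\<Sum>c\<in>{c \<in> C. a \<in> c}. x c)" if "a \<in> X" for a
    using that by (simp add: z_def phi_apply)
  have one: "(\<Sum>c\<in>cycles L. x c) = 1" if "L \<in> Ls" for L
    using assms that by (simp add: P_LP_cXTTP_def Let_def)
  have x_nonneg: "x c \<ge> 0" if "c \<in> C" for c
    using assms that by (simp add: P_LP_cXTTP_def Let_def)
  have nonneg: "z a \<ge> 0" if "a \<in> X" for a
    unfolding z_X[OF that] by (rule sum_nonneg) (simp add: x_nonneg)
  have act: "(\<Sum>a\<in>A \<alpha>. z a) = 1" if "L \<in> Ls" "\<alpha> \<in> vehicle_activities L" for L \<alpha>
  proof -
    have "(\<Sum>a\<in>A \<alpha>. z a) = (\<Sum>a\<in>A \<alpha>. \<Sum>c\<in>{c \<in> C. a \<in> c}. x c)"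
      using xarcs_subset_X[OF that] by (intro sum.cong) (auto simp: z_X)
    then show ?thesis using sum_arcs_of_activity[OF that] one[OF that(1)] by simp
  qed
  \<comment> \<open>The cycle polyhedron has no explicit upper bound; here it follows because
    \<open>z a\<close> is one of the nonnegative terms of an activity sum equal to 1.\<close>
  have le: "z a \<le> 1" if a: "a \<in> X" for a
  proof -
    obtain L \<alpha> where L: "L \<in> Ls" "\<alpha> \<in> vehicle_activities L" "a \<in> A \<alpha>"
      using a by (auto simp: X_eq simp del: split_paired_Ex)
    have "z a \<le> (\<Sum>a\<in>A \<alpha>. z a)"
      using L nonneg xarcs_subset_X[OF L(1,2)] by (intro member_le_sum finite_xarcs) auto
    then show ?thesis using act[OF L(1,2)] by simp
  qed
  have flow: "(\<Sum>a\<in>{a \<in> X. snd a = v}. z a) - (\<Sum>a\<in>{a \<in> X. fst a = v}. z a) = 0" for v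
    using flow_conservation[where v = v and x = x] by (simp add: z_X)
  have "z \<in> qvec X" by (simp add: z_def phi_apply qvec_def)
  moreover have "z a - (\<Sum>p\<in>{p \<in> P s t. uses p a}. y p) \<ge> 0" if "a \<in> X" "(s, t) \<in> OD" for a s t
    using assms that unfolding z_X[OF that(1)] P_LP_cXTTP_def Let_def by blast
  moreover have "y \<in> qvec (all_paths OD P)" "\<forall>(s, t)\<in>OD. (\<Sum>p\<in>P s t. y p) = 1"
    "\<forall>p\<in>all_paths OD P. y p \<ge> 0"
    using assms by (simp_all add: P_LP_cXTTP_def Let_def)
  ultimately show ?thesis
    unfolding z P_LP_XTTP_def Let_def vehicle_acts_def using act flow nonneg le by blast
qed

text \<open>Integrality leaves a single arc of weight 1 over each activity, so the flow makes one
  turn per line. A fractional flow may instead circulate along walks that wind around the line cycle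
  twice.\<close>

lemma phi_integral_surj:
  fixes y :: "('v, 'z) apath \<Rightarrow> rat"
  assumes LP: "(z, y) \<in> P_LP_XTTP Ls T l u OD P" and int: "\<forall>a\<in>X. z a \<in> \<int>"
  obtains x where "(x, y) \<in> P_LP_cXTTP Ls T l u OD P" "\<forall>c\<in>C. x c \<in> \<int>"
    "phi Ls T l u (x, y) = (z, y)"
proof -
  have act: "(\<Sum>a\<in>A \<alpha>. z a) = 1" if "L \<in> Ls" "\<alpha> \<in> vehicle_activities L" for L \<alpha>
    using LP that unfolding P_LP_XTTP_def Let_def vehicle_acts_def by blast
  have z01: "z a = 0 \<or> z a = 1" if "a \<in> X" for a
  proof -
    have "0 \<le> z a" "z a \<le> 1"
      using LP that by (auto simp: P_LP_XTTP_def Let_def simp del: split_paired_All)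
    moreover have "z a \<in> \<int>" using int that by blast
    then obtain k where "z a = of_int k" by (rule Ints_cases)
    ultimately have "k = 0 \<or> k = 1" by auto
    then show ?thesis using \<open>z a = of_int k\<close> by auto
  qed
  have flow: "(\<Sum>a\<in>{a \<in> X. snd a = v}. z a) = (\<Sum>a\<in>{a \<in> X. fst a = v}. z a)"
    if "L \<in> Ls" "v \<in> events L \<times> {..<T}" for L v
  proof -
    have "v \<in> pverts (xean Ls T l u)" using that by (auto simp: xean_def ean_def)
    then show ?thesis using LP by (simp add: P_LP_XTTP_def Let_def)
  qed
  have ex1: "\<exists>!a. a \<in> A \<alpha> \<and> z a = 1" if "L \<in> Ls" "\<alpha> \<in> vehicle_activities L" for L \<alpha>
  proof -
    \<comment> \<open>The weights are 0 or 1, so the activity sum counts the arcs of weight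
      1.\<close>
    have "(\<Sum>a\<in>A \<alpha>. z a) = (\<Sum>a\<in>{a \<in> A \<alpha>. z a = 1}. 1)"
    proof (rule sum.mono_neutral_cong_right[OF finite_xarcs])
      show "\<forall>a\<in>A \<alpha> - {a \<in> A \<alpha>. z a = 1}. z a = 0"
        using z01 xarcs_subset_X[OF that] by blast
    qed auto
    then have "card {a \<in> A \<alpha>. z a = 1} = 1" using act[OF that] by simp
    then obtain a where "{a \<in> A \<alpha>. z a = 1} = {a}" by (rule card_1_singletonE)
    then show ?thesis by (intro ex1I[of _ a]) blast+
  qed
  define chosen where "chosen \<alpha> = (THE a. a \<in> A \<alpha> \<and> z a = 1)" for \<alpha>
  have chosen: "chosen \<alpha> \<in> A \<alpha>" "z (chosen \<alpha>) = 1"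
    if "L \<in> Ls" "\<alpha> \<in> vehicle_activities L" for L \<alpha>
    using theI'[OF ex1[OF that]] by (simp_all add: chosen_def)
  have chosen_unique: "chosen \<alpha> = a"
    if "L \<in> Ls" "\<alpha> \<in> vehicle_activities L" "a \<in> A \<alpha>" "z a = 1" for L \<alpha> a
    using ex1[OF that(1,2)] chosen[OF that(1,2)] that(3,4) by blast
  define cyc where "cyc L = chosen ` vehicle_activities L" for L
  have cyc: "cyc L \<in> cycles L" if L: "L \<in> Ls" for L
  proof -
    let ?a = "\<lambda>k. chosen (event_at L k, event_at L (Suc k))"
    have step: "(event_at L k, event_at L (Suc k)) \<in> vehicle_activities L" for k
      by (rule event_at_step_in_vehicle_activities[OF length_line[OF L]])
    have mem: "?a k \<in> A (event_at L k, event_at L (Suc k))" and z_a: "z (?a k) = 1" for k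
      using chosen[OF L step] by auto
    \<comment> \<open>The chosen arc brings positive inflow to its head, so conservation yields an
      arc \<open>b\<close> of non-zero weight leaving it; uniqueness identifies \<open>b\<close>
      with the next chosen arc.\<close>
    have chain: "snd (?a k) = fst (?a (Suc k))" for k
    proof -
      define v where "v = snd (?a k)"
      have v: "fst v = event_at L (Suc k)" "snd v < T"
        using xarcs_project[OF mem[of k]] xarcs_time[OF mem[of k]] by (simp_all add: v_def)
      then have "v \<in> events L \<times> {..<T}"
        using event_at_in_events[OF length_line[OF L]] by (simp add: mem_Times_iff)
      have "?a k \<in> X" using mem xarcs_subset_X[OF L step] by blast
      have "0 < (\<Sum>a\<in>{a \<in> X. snd a = v}. z a)"
      proof (rule sum_pos2)
        show "finite {a \<in> X. snd a = v}" using finite_X by simp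
        show "?a k \<in> {a \<in> X. snd a = v}" using \<open>?a k \<in> X\<close> by (simp add: v_def)
        show "0 < z (?a k)" using z_a by simp
        show "0 \<le> z a" if "a \<in> {a \<in> X. snd a = v}" for a using z01[of a] that by auto
      qed
      also have "\<dots> = (\<Sum>a\<in>{a \<in> X. fst a = v}. z a)"
        by (rule flow[OF L \<open>v \<in> events L \<times> {..<T}\<close>])
      finally obtain b where b: "b \<in> X" "fst b = v" "z b \<noteq> 0"
        by (metis (mono_tags, lifting) less_irrefl mem_Collect_eq sum.neutral)
      \<comment> \<open>A priori \<open>b\<close> may lie on any line; its tail event fixes first
        the line and then the index modulo the period.\<close>
      obtain L' \<beta> where \<beta>: "L' \<in> Ls" "\<beta> \<in> vehicle_activities L'" "b \<in> A \<beta>"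
        using b(1) unfolding X_eq by blast
      have ev: "fst \<beta> = event_at L (Suc k)" using xarcs_project[OF \<beta>(3)] b(2) v(1) by auto
      have "L' = fst (snd (event_at L (Suc k)))"
        using vehicle_activities_line_of[OF \<beta>(1,2)] ev by simp
      also have "\<dots> = L" using event_at_in_events[OF length_line[OF L]] by (rule fst_snd_events)
      finally have "L' = L" .
      obtain j where j: "\<beta> = (event_at L j, event_at L (Suc j))"
        using \<beta>(2) vehicle_activities_line[OF L] \<open>L' = L\<close> by auto
      then have "j mod period L = Suc k mod period L"
        using ev by (simp add: event_at_eq_line[OF L])
      then have "Suc j mod period L = Suc (Suc k) mod period L" by (metis mod_Suc_eq)
      then have "\<beta> = (event_at L (Suc k), event_at L (Suc (Suc k)))"
        using j ev by (simp add: event_at_eq_line[OF L])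
      then have "?a (Suc k) = b" using chosen_unique[OF \<beta>] z01[OF b(1)] b(3) by simp
      then show ?thesis using b(2) v_def by simp
    qed
    \<comment> \<open>The chosen arc depends on the activity alone, so the sequence repeats after
      one period and the times of its nodes match up as well.\<close>
    have "event_at L (period L) = event_at L 0" "event_at L (Suc (period L)) = event_at L (Suc 0)"
      by (simp_all add: event_at_eq_line[OF L] mod_Suc)
    then have "?a ` {..<period L} \<in> cycles L"
      by (intro line_cyclesI[OF L mem chain]) simp
    moreover have "?a ` {..<period L} = cyc L"
      unfolding cyc_def vehicle_activities_line[OF L]
    proof (intro equalityI subsetI)
      fix a assume "a \<in> chosen ` range (\<lambda>k. (event_at L k, event_at L (Suc k)))"
      then obtain k where "a = ?a k" by blast
      also have "(event_at L k, event_at L (Suc k)) =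
          (event_at L (k mod period L), event_at L (Suc (k mod period L)))"
        by (simp add: event_at_eq_line[OF L] mod_Suc_eq)
      finally show "a \<in> ?a ` {..<period L}"
        using period_pos[OF L] by (intro image_eqI[of _ _ "k mod period L"]) simp_all
    qed blast
    ultimately show ?thesis by simp
  qed
  have mem_cyc: "a \<in> cyc L \<longleftrightarrow> z a = 1" if "L \<in> Ls" "\<alpha> \<in> vehicle_activities L" "a \<in> A \<alpha>" for a L \<alpha>
  proof
    assume "a \<in> cyc L"
    then show "z a = 1" using chosen that(1) by (auto simp: cyc_def simp del: split_paired_All)
  next
    assume "z a = 1"
    then show "a \<in> cyc L" using chosen_unique[OF that] that(2) by (auto simp: cyc_def)
  qed
  \<comment> \<open>Selected cycles of different lines stay apart, so the indicator sums to 1 over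
    each \<open>cycles L\<close>.\<close>
  have cyc_same: "L' = L" if "L \<in> Ls" "L' \<in> Ls" "cyc L' \<in> cycles L" for L L'
  proof -
    have "vehicle_activities L' \<noteq> {}" by (simp add: vehicle_activities_def turnaround_def)
    then obtain \<alpha> where \<alpha>: "\<alpha> \<in> vehicle_activities L'" by blast
    then have "chosen \<alpha> \<in> cyc L'" by (simp add: cyc_def)
    then show ?thesis
      by (rule same_line[OF that(1,3) _ that(2) \<alpha> chosen(1)[OF that(2) \<alpha>]])
  qed
  define x where "x c = (if c \<in> cyc ` Ls then 1 else 0 :: rat)" for c
  have x_z: "(\<Sum>c\<in>{c \<in> C. a \<in> c}. x c) = z a" if a: "a \<in> X" for a
  proof -
    obtain L \<alpha> where L: "L \<in> Ls" "\<alpha> \<in> vehicle_activities L" "a \<in> A \<alpha>"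
      using a unfolding X_eq by blast
    \<comment> \<open>Since \<open>a\<close> lies over an activity of \<open>L\<close>, no selected
      cycle other than \<open>cyc L\<close> can contain it.\<close>
    have "(\<Sum>c\<in>{c \<in> C. a \<in> c}. x c) = (\<Sum>c\<in>{c \<in> {cyc L}. a \<in> c}. 1)"
    proof (rule sum.mono_neutral_cong_right)
      show "finite {c \<in> C. a \<in> c}" using finite_C by simp
      show "{c \<in> {cyc L}. a \<in> c} \<subseteq> {c \<in> C. a \<in> c}" using cyc[OF L(1)] cycles_subset_C[OF L(1)] by blast
      show "\<forall>c\<in>{c \<in> C. a \<in> c} - {c \<in> {cyc L}. a \<in> c}. x c = 0"
      proof
        fix c assume c: "c \<in> {c \<in> C. a \<in> c} - {c \<in> {cyc L}. a \<in> c}"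
        have "c \<notin> cyc ` Ls"
        proof
          assume "c \<in> cyc ` Ls"
          then obtain L' where L': "L' \<in> Ls" "c = cyc L'" by blast
          then have "L = L'" using same_line[OF L'(1) cyc[OF L'(1)] _ L] c by blast
          with c L' show False by blast
        qed
        then show "x c = 0" by (simp add: x_def)
      qed
      show "x c = 1" if "c \<in> {c \<in> {cyc L}. a \<in> c}" for c using that L(1) by (simp add: x_def)
    qed
    also have "\<dots> = (if a \<in> cyc L then 1 else 0)" by (simp add: Collect_conv_if)
    also have "\<dots> = z a" using mem_cyc[OF L] z01[OF a] by auto
    finally show ?thesis .
  qed
  show ?thesis
  proof (rule that[of x])
    show "phi Ls T l u (x, y) = (z, y)"
    proof -
      have "z \<in> qvec X" using LP by (simp add: P_LP_XTTP_def Let_def)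
      then show ?thesis by (auto simp: phi_apply x_z qvec_def fun_eq_iff)
    qed
    show "\<forall>c\<in>C. x c \<in> \<int>" by (simp add: x_def)
    have "(\<Sum>c\<in>cycles L. x c) = 1" if L: "L \<in> Ls" for L
    proof -
      have "(\<Sum>c\<in>cycles L. x c) = (\<Sum>c\<in>{cyc L}. 1)"
        using cyc cyc_same L finite_subset[OF cycles_subset_C[OF L] finite_C]
        by (intro sum.mono_neutral_cong_right) (auto simp: x_def)
      then show ?thesis by simp
    qed
    moreover have "x \<in> qvec C" using cyc cycles_subset_C by (auto simp: qvec_def x_def)
    moreover have "(\<Sum>c\<in>{c \<in> C. a \<in> c}. x c) - (\<Sum>p\<in>{p \<in> P s t. uses p a}. y p) \<ge> 0"
      if "a \<in> X" "(s, t) \<in> OD" for a s t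
      using LP that unfolding x_z[OF that(1)] P_LP_XTTP_def Let_def by blast
    moreover have "\<forall>c\<in>C. x c \<ge> 0" by (simp add: x_def)
    moreover have "y \<in> qvec (all_paths OD P)" "\<forall>(s, t)\<in>OD. (\<Sum>p\<in>P s t. y p) = 1"
      "\<forall>p\<in>all_paths OD P. y p \<ge> 0"
      using LP by (simp_all add: P_LP_XTTP_def Let_def)
    ultimately show "(x, y) \<in> P_LP_cXTTP Ls T l u OD P"
      unfolding P_LP_cXTTP_def Let_def by blast
  qed
qed

text \<open>The coefficients of \<open>phi\<close> are 0 and 1, so integrality is preserved; the
  other inclusion is \<open>phi_integral_surj\<close>. This is the equality of generators that
  passes to the hulls.\<close>

lemma phi_integral_points:
  fixes P :: "('v, 'z) anode \<Rightarrow> ('v, 'z) anode \<Rightarrow> ('v, 'z) apath set"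
  shows "phi Ls T l u ` {(x, y) \<in> P_LP_cXTTP Ls T l u OD P. \<forall>c\<in>C. x c \<in> \<int>} =
    {(x, y) \<in> P_LP_XTTP Ls T l u OD P. \<forall>a\<in>X. x a \<in> \<int>}" (is "_ ` ?S = ?R")
proof (intro equalityI subsetI)
  fix w assume "w \<in> phi Ls T l u ` ?S"
  then obtain x y where *: "w = phi Ls T l u (x, y)" "(x, y) \<in> P_LP_cXTTP Ls T l u OD P"
    "\<forall>c\<in>C. x c \<in> \<int>" by auto
  moreover have "(\<Sum>c\<in>{c \<in> C. a \<in> c}. x c) \<in> \<int>" for a using *(3) by (intro Ints_sum) auto
  ultimately show "w \<in> ?R" using phi_LP[OF *(2)] by (simp add: phi_apply)
next
  fix w assume "w \<in> ?R"
  then obtain z y where w: "w = (z, y)" "(z, y) \<in> P_LP_XTTP Ls T l u OD P" "\<forall>a\<in>X. z a \<in> \<int>"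
    by auto
  obtain x where "(x, y) \<in> P_LP_cXTTP Ls T l u OD P" "\<forall>c\<in>C. x c \<in> \<int>"
    "phi Ls T l u (x, y) = (z, y)" by (rule phi_integral_surj[OF w(2,3)])
  then show "w \<in> phi Ls T l u ` ?S" using w(1) by (intro image_eqI[of _ _ "(x, y)"]) auto
qed

end


section \<open>Linear maps and rational convex hulls\<close>

text \<open>Makes pairs of rational functions a rational vector space under pointwise operations, so
  that linear maps between such spaces are available.\<close>

interpretation qscale: vector_space "qscale :: rat \<Rightarrow> ('i \<Rightarrow> rat) \<times> ('j \<Rightarrow> rat) \<Rightarrow> _"
  by unfold_locales (auto simp: qscale_def fun_eq_iff prod_eq_iff algebra_simps)

lemma linear_phi:
  "Vector_Spaces.linear qscale qscale
     (phi Ls T l u :: ('v xarc set \<Rightarrow> rat) \<times> (('v, 'z) apath \<Rightarrow> rat) \<Rightarrow> _)"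
  by unfold_locales
    (auto simp: phi_def qscale_def fun_eq_iff prod_eq_iff sum.distrib sum_distrib_left)

lemma qconvexD:
  "qconvex S \<Longrightarrow> z \<in> S \<Longrightarrow> w \<in> S \<Longrightarrow> 0 \<le> a \<Longrightarrow> 0 \<le> b \<Longrightarrow> a + b = 1 \<Longrightarrow>
    qscale a z + qscale b w \<in> S"
  by (simp add: qconvex_def)

text \<open>Intersections of convex sets are convex.\<close>

lemma qconvex_hull: "qconvex (qconvex hull S)"
  by (rule hull_in) (auto simp: qconvex_def)

text \<open>Both inclusions come from minimality of the hull: under a linear map, preimages and
  images of convex sets are convex.\<close>

lemma linear_image_qconvex_hull:
  assumes "Vector_Spaces.linear qscale qscale f"
  shows "f ` (qconvex hull S) = qconvex hull (f ` S)"
proof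
  interpret f: Vector_Spaces.linear qscale qscale f by fact
  have comb: "f (qscale a z + qscale b w) = qscale a (f z) + qscale b (f w)" for a b z w
    by (simp add: f.add f.scale)
  have "qconvex {z. f z \<in> qconvex hull (f ` S)}"
    using qconvex_hull[of "f ` S"] by (simp add: qconvex_def comb)
  moreover have "S \<subseteq> {z. f z \<in> qconvex hull (f ` S)}" by (auto intro: hull_inc)
  ultimately have "qconvex hull S \<subseteq> {z. f z \<in> qconvex hull (f ` S)}" by (rule hull_minimal[rotated])
  then show "f ` (qconvex hull S) \<subseteq> qconvex hull (f ` S)" by blast
  have "qconvex (f ` (qconvex hull S))"
  proof (rule qconvex_def[THEN iffD2], intro ballI allI impI)
    fix z' w' and a b :: rat
    assume "z' \<in> f ` (qconvex hull S)" "w' \<in> f ` (qconvex hull S)"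
    then obtain z w where zw: "z' = f z" "w' = f w" "z \<in> qconvex hull S" "w \<in> qconvex hull S"
      by blast
    assume "0 \<le> a" "0 \<le> b" "a + b = 1"
    then have "qscale a z + qscale b w \<in> qconvex hull S"
      by (rule qconvexD[OF qconvex_hull zw(3,4)])
    then show "qscale a z' + qscale b w' \<in> f ` (qconvex hull S)"
      unfolding zw(1,2) comb[symmetric] by blast
  qed
  then show "qconvex hull (f ` S) \<subseteq> f ` (qconvex hull S)"
    by (intro hull_minimal image_mono hull_subset)
qed

theorem theorem7p3:
  fixes G :: "('v, 'e) pre_digraph"
    and Ls :: "'v line set"
    and T :: nat
    and l u :: "'v activity \<Rightarrow> int"
    and Z :: "'z set"
    and B OD :: "(('v, 'z) anode \<times> ('v, 'z) anode) set"
    and P :: "('v, 'z) anode \<Rightarrow> ('v, 'z) anode \<Rightarrow> ('v, 'z) apath set"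
    and H :: "('v, 'z) anode pair_pre_digraph"
  assumes "line_network G Ls"
    and "T \<ge> 1"
    and "\<forall>\<alpha>\<in>parcs (ean Ls). l \<alpha> \<le> u \<alpha>"
    and "H = augmented (xean Ls T l u) Z B"
    and "B \<subseteq> pverts H \<times> pverts H" and "B \<inter> emb ` xvehicle Ls T l u = {}"
    and "finite OD" and "OD \<subseteq> pverts H \<times> pverts H"
    and "\<forall>(s, t)\<in>OD. finite (P s t) \<and> (\<forall>p\<in>P s t. od_path H s t p)"
  shows "Vector_Spaces.linear qscale qscale
           (phi Ls T l u :: ('v xarc set \<Rightarrow> rat) \<times> (('v, 'z) apath \<Rightarrow> rat) \<Rightarrow> _) \<and>
         phi Ls T l u ` (qvec (all_cycles Ls T l u) \<times> qvec (all_paths OD P))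
           \<subseteq> qvec (xvehicle Ls T l u) \<times> qvec (all_paths OD P) \<and>
         phi Ls T l u ` P_MIP_cXTTP Ls T l u OD P = P_MIP_XTTP Ls T l u OD P \<and>
         phi Ls T l u ` P_LP_cXTTP Ls T l u OD P \<subseteq> P_LP_XTTP Ls T l u OD P"
proof -
  \<comment> \<open>A \<open>vpath\<close> repeats no vertex, and a walk with at least one arc has
    at least two stops.\<close>
  interpret timetable Ls T l u
    using assms(1) by unfold_locales (auto simp: line_network_def vpath_def)
  have "phi Ls T l u ` (qvec C \<times> qvec (all_paths OD P)) \<subseteq> qvec X \<times> qvec (all_paths OD P)"
    by (auto simp: phi_apply qvec_def)
  \<comment> \<open>Both polyhedra are hulls of integral points, so \<open>phi\<close> moves inside
    the hull and acts on the generators.\<close>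
  moreover have "phi Ls T l u ` P_MIP_cXTTP Ls T l u OD P = P_MIP_XTTP Ls T l u OD P"
    unfolding P_MIP_cXTTP_def P_MIP_XTTP_def linear_image_qconvex_hull[OF linear_phi]
      phi_integral_points ..
  moreover have "phi Ls T l u ` P_LP_cXTTP Ls T l u OD P \<subseteq> P_LP_XTTP Ls T l u OD P"
    using phi_LP by auto
  ultimately show ?thesis by (intro conjI linear_phi)
qed

end
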